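(* Let $n \geqslant 1$ be an integer and let $v_1, \dots, v_n > 0$ be real numbers. Let $X_1, \dots, X_n$ be independent real random variables such that, for every $i \in \{1,\dots,n\}$, $X_i$ is uniformly distributed on the interval $[-v_i, v_i]$. For $\lambda, t > 0$ define $$\phi(\lambda,t) = \sum_{i=1}^n \log\left( \frac{e^{\lambda v_i}-e^{-\lambda v_i}}{2 \lambda v_i} \right) - \lambda t.$$ Then, for all $t > 0$, $$\mathbb{P}\left( \left| \sum_{i=1}^n X_i \right| \geqslant t \right) \leqslant 2 \inf_{\lambda>0} \left\{ \exp \left( \phi(\lambda,t) \right) \right\}.$$
   Context: $\log$ denotes the natural logarithm. *)

theory Defs
  imports "HOL-Probability.Probability"
begin

definition phi :: "nat \<Rightarrow> (nat \<Rightarrow> real) \<Rightarrow> real \<Rightarrow> real \<Rightarrow> real" where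
  "phi n v lam t =
     (\<Sum>i\<in>{1..n}. ln ((exp (lam * v i) - exp (- (lam * v i))) / (2 * lam * v i))) - lam * t"

end

theory Submission
  imports Defs
begin

text \<open>
  Chernoff's bound for each of the two tails: by independence the moment generating function of
  \<open>\<Sum>i. X i\<close> factorises, and each factor \<open>sinh (c * v i) / (c * v i)\<close> is even in \<open>c\<close>, so that the
  upper and the lower tail obey the same estimate \<open>exp (phi n v lam t)\<close>, for every \<open>lam > 0\<close>.
\<close>

text \<open>The antiderivative \<open>exp (c * x) / c\<close> gives the moment generating function
  of a uniform law. Negative \<open>c\<close> is allowed because the lower tail uses it.\<close>

lemma nn_integral_exp_uniform_measure:
  fixes a b c :: real
  assumes "a < b" and "c \<noteq> 0"
  shows "(\<integral>\<^sup>+x. ennreal (exp (c * x)) \<partial>uniform_measure lborel {a..b}) =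
    ennreal ((exp (c * b) - exp (c * a)) / (c * (b - a)))"
proof -
  have "(\<integral>\<^sup>+x. ennreal (exp (c * x)) * indicator {a..b} x \<partial>lborel) =
      ennreal (exp (c * b) / c - exp (c * a) / c)"
    using assms by (intro nn_integral_FTC_Icc[where F = "\<lambda>x. exp (c * x) / c"])
      (auto intro!: derivative_eq_intros)
  \<comment> \<open>\<open>exp (c * b) - exp (c * a)\<close> has the sign of \<open>c\<close>.
    Nonnegativity lets \<open>divide_ennreal\<close> carry the division by the length
    \<open>b - a\<close> inside \<open>ennreal\<close>.\<close>
  moreover have "0 \<le> exp (c * b) / c - exp (c * a) / c"
    using assms by (cases "c > 0") (auto simp: field_simps)
  ultimately show ?thesis
    using assms by (simp add: nn_integral_uniform_measure divide_ennreal diff_divide_distrib)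
qed

lemma sinh_quotient_pos:
  fixes x :: real
  assumes "x \<noteq> 0"
  shows "0 < (exp x - exp (- x)) / (2 * x)"
  using assms by (cases "x > 0") (auto simp: zero_less_divide_iff)

text \<open>The sign \<open>s\<close> selects the upper tail (\<open>1\<close>) or the lower tail
  (\<open>-1\<close>), so that one argument serves both.\<close>

lemma (in prob_space) Chernoff_uniform_tail:
  fixes X :: "nat \<Rightarrow> 'a \<Rightarrow> real" and v :: "nat \<Rightarrow> real" and lam s t :: real
  assumes v: "\<And>i. i \<in> {1..n} \<Longrightarrow> v i > 0"
    and indep: "indep_vars (\<lambda>_. borel) X {1..n}"
    and distr: "\<And>i. i \<in> {1..n} \<Longrightarrow> distr M borel (X i) = uniform_measure lborel {- v i..v i}"
    and lam: "lam > 0" and s: "s = 1 \<or> s = -1"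
  shows "\<P>(\<omega> in M. t \<le> s * (\<Sum>i\<in>{1..n}. X i \<omega>)) \<le> exp (phi n v lam t)"
proof -
  have X [measurable]: "X i \<in> borel_measurable M" if "i \<in> {1..n}" for i
    using indep that unfolding indep_vars_def by blast
  \<comment> \<open>The argument of \<open>ln\<close> in \<open>phi\<close>, which turns out to be
    the moment generating function of \<open>X i\<close> at both \<open>lam\<close> and
    \<open>- lam\<close>.\<close>
  define q where "q i = (exp (lam * v i) - exp (- (lam * v i))) / (2 * lam * v i)" for i
  have q_pos: "q i > 0" if "i \<in> {1..n}" for i
    using sinh_quotient_pos[of "lam * v i"] v[OF that] lam by (simp add: q_def mult.assoc)
  have mgf: "(\<integral>\<^sup>+\<omega>. ennreal (exp (lam * s * X i \<omega>)) \<partial>M) = ennreal (q i)"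
    if i: "i \<in> {1..n}" for i
  proof -
    have "(\<integral>\<^sup>+\<omega>. ennreal (exp (lam * s * X i \<omega>)) \<partial>M) =
        (\<integral>\<^sup>+x. ennreal (exp (lam * s * x)) \<partial>distr M borel (X i))"
      using i by (subst nn_integral_distr) auto
    also have "\<dots> = ennreal ((exp (lam * s * v i) - exp (lam * s * (- v i))) / (lam * s * (2 * v i)))"
      using s lam v[OF i] by (subst distr[OF i], subst nn_integral_exp_uniform_measure) auto
    \<comment> \<open>For \<open>s = -1\<close> numerator and denominator both change sign.\<close>
    also have "(exp (lam * s * v i) - exp (lam * s * (- v i))) / (lam * s * (2 * v i)) = q i"
      using s lam v[OF i] by (auto simp: q_def field_simps)
    finally show ?thesis .
  qed
  have "ennreal (\<P>(\<omega> in M. t \<le> s * (\<Sum>i\<in>{1..n}. X i \<omega>))) =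
      emeasure M {\<omega> \<in> space M. t \<le> s * (\<Sum>i\<in>{1..n}. X i \<omega>)}"
    by (simp add: emeasure_eq_measure)
  also have "\<dots> \<le> ennreal (exp (- lam * t)) *
      (\<integral>\<^sup>+\<omega>\<in>space M. exp (lam * (s * (\<Sum>i\<in>{1..n}. X i \<omega>))) \<partial>M)"
    by (intro Chernoff_ineq_nn_integral_ge lam) auto
  also have "(\<integral>\<^sup>+\<omega>\<in>space M. exp (lam * (s * (\<Sum>i\<in>{1..n}. X i \<omega>))) \<partial>M) =
      (\<integral>\<^sup>+\<omega>. (\<Prod>i\<in>{1..n}. ennreal (exp (lam * s * X i \<omega>))) \<partial>M)"
    by (intro nn_integral_cong) (simp add: sum_distrib_left exp_sum prod_ennreal mult.assoc)
  also have "\<dots> = (\<Prod>i\<in>{1..n}. \<integral>\<^sup>+\<omega>. ennreal (exp (lam * s * X i \<omega>)) \<partial>M)"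
    by (intro indep_vars_nn_integral indep_vars_compose2[OF indep]) auto
  also have "\<dots> = ennreal (\<Prod>i\<in>{1..n}. q i)"
    by (subst prod_ennreal[symmetric]) (auto simp: mgf intro!: less_imp_le[OF q_pos])
  \<comment> \<open>Positivity of \<open>q i\<close> ensures that \<open>exp\<close> undoes
    \<open>ln\<close>.\<close>
  also have "(\<Prod>i\<in>{1..n}. q i) = exp (\<Sum>i\<in>{1..n}. ln (q i))"
    using q_pos by (simp add: exp_sum)
  also have "ennreal (exp (- lam * t)) * ennreal (exp (\<Sum>i\<in>{1..n}. ln (q i))) =
      ennreal (exp (phi n v lam t))"
    by (simp add: phi_def q_def flip: ennreal_mult exp_add)
  finally show ?thesis
    by simp
qed

theorem proposition2:
  fixes M :: "'a measure" and n :: nat and v :: "nat \<Rightarrow> real"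
    and X :: "nat \<Rightarrow> 'a \<Rightarrow> real" and t :: real
  assumes "prob_space M"
    and "n \<ge> 1"
    and "\<And>i. i \<in> {1..n} \<Longrightarrow> v i > 0"
    and "prob_space.indep_vars M (\<lambda>_. borel) X {1..n}"
    and "\<And>i. i \<in> {1..n} \<Longrightarrow> distr M borel (X i) = uniform_measure lborel {- v i..v i}"
    and "t > 0"
  shows "\<P>(\<omega> in M. \<bar>\<Sum>i\<in>{1..n}. X i \<omega>\<bar> \<ge> t) \<le> 2 * (INF lam\<in>{0<..}. exp (phi n v lam t))"
proof -
  interpret prob_space M by fact
  have X [measurable]: "X i \<in> borel_measurable M" if "i \<in> {1..n}" for i
    using assms(4) that unfolding indep_vars_def by blast
  let ?tail = "\<lambda>s. {\<omega> \<in> space M. t \<le> s * (\<Sum>i\<in>{1..n}. X i \<omega>)}"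
  \<comment> \<open>Halving the probability makes it a lower bound of the very family whose infimum
    is taken; the factor 2 returns at the end.\<close>
  have "prob {\<omega> \<in> space M. \<bar>\<Sum>i\<in>{1..n}. X i \<omega>\<bar> \<ge> t} / 2 \<le> exp (phi n v lam t)"
    if "lam > 0" for lam
  proof -
    have "{\<omega> \<in> space M. \<bar>\<Sum>i\<in>{1..n}. X i \<omega>\<bar> \<ge> t} = ?tail 1 \<union> ?tail (-1)"
      by auto
    moreover have "prob (?tail 1 \<union> ?tail (-1)) \<le> prob (?tail 1) + prob (?tail (-1))"
      by (intro measure_Un_le) measurable
    moreover have "prob (?tail s) \<le> exp (phi n v lam t)" if "s = 1 \<or> s = -1" for s
      by (rule Chernoff_uniform_tail) (use assms \<open>lam > 0\<close> that in auto)
    from this[of 1] this[of "-1"]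
    have "prob (?tail 1) + prob (?tail (-1)) \<le> 2 * exp (phi n v lam t)"
      by linarith
    ultimately show ?thesis
      by simp
  qed
  then have "prob {\<omega> \<in> space M. \<bar>\<Sum>i\<in>{1..n}. X i \<omega>\<bar> \<ge> t} / 2 \<le>
      (INF lam\<in>{0<..}. exp (phi n v lam t))"
    \<comment> \<open>The bound holds for every positive \<open>lam\<close>, and
      \<open>{0<..}\<close> is nonempty, as an infimum in the reals requires.\<close>
    by (intro cINF_greatest) auto
  then show ?thesis
    by simp
qed

end
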